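(* Let $G$ be a connected graph of order $n\ge 2$ and let $H$ be an arbitrary graph. If there exist two adjacency bases $W_1$ and $W_2$ of $H$ such that there is no vertex of $H$ with adjacency representation entirely $1$ with respect to $W_1$ and no vertex of $H$ with adjacency representation entirely $2$ with respect to $W_2$, then $\beta(G[H])=\beta(G[\overline{H}])=n\,\beta_2(H)$.
   Context: All graphs are finite and simple; $\overline{H}$ is the complement of $H$, and $u\sim v$ means that $u,v$ are adjacent. For a connected graph $X$, an ordered set $W=\{w_1,\dots,w_k\}\subseteq V(X)$ is a resolving set if the vectors $(d_X(v,w_1),\dots,d_X(v,w_k))$, $v\in V(X)$, are pairwise distinct ($d_X$ is the graph distance); the metric dimension $\beta(X)$ is the minimum cardinality of a resolving set of $X$. For any graph $H$ and vertices $v,w$, set $a_H(v,w)=0$ if $v=w$, $a_H(v,w)=1$ if $v\sim w$, and $a_H(v,w)=2$ if $v\ne w$ and $v\nsim w$. For an ordered set $W=\{w_1,\dots,w_k\}\subseteq V(H)$ the adjacency representation of $v$ with respect to $W$ is $r_2(v|W)=(a_H(v,w_1),\dots,a_H(v,w_k))$; it is entirely $i$ if all its entries equal $i$. $W$ is an adjacency resolving set of $H$ if distinct vertices of $H$ have distinct adjacency representations with respect to $W$; the adjacency metric dimension $\beta_2(H)$ is the minimum cardinality of an adjacency resolving set, and an adjacency basis of $H$ is an adjacency resolving set of cardinality $\beta_2(H)$. The lexicographic product $G[H]$ has vertex set $V(G)\times V(H)$, with $(v,u)$ and $(v',u')$ adjacent iff $v\sim v'$ in $G$, or $v=v'$ and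 $u\sim u'$ in $H$. *)

theory Defs
  imports
    "Graph_Theory.Pair_Digraph"
    "Graph_Theory.Digraph_Component"
    "Graph_Theory.Shortest_Path"
begin

text \<open>
  A finite simple graph is a \<open>pair_graph\<close>: a finite vertex set \<open>pverts\<close> with a symmetric,
  irreflexive set \<open>parcs\<close> of ordered pairs of vertices, so that \<open>u\<close> and \<open>v\<close> are adjacent iff
  \<open>(u, v) \<in> parcs H\<close>.
\<close>

definition complement_graph :: "'a pair_pre_digraph \<Rightarrow> 'a pair_pre_digraph" where
  "complement_graph H =
    \<lparr> pverts = pverts H,
      parcs = {(u, v). u \<in> pverts H \<and> v \<in> pverts H \<and> u \<noteq> v \<and> (u, v) \<notin> parcs H} \<rparr>"

definition lex_product ::
    "'a pair_pre_digraph \<Rightarrow> 'b pair_pre_digraph \<Rightarrow> ('a \<times> 'b) pair_pre_digraph" where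
  "lex_product G H =
    \<lparr> pverts = pverts G \<times> pverts H,
      parcs = {((v, u), (v', u')).
        (v, u) \<in> pverts G \<times> pverts H \<and> (v', u') \<in> pverts G \<times> pverts H \<and>
        ((v, v') \<in> parcs G \<or> v = v' \<and> (u, u') \<in> parcs H)} \<rparr>"

lemma pair_graph_complement_graph:
  assumes "pair_graph H"
  shows "pair_graph (complement_graph H)"
proof -
  interpret pair_graph H by (rule assms)
  have "parcs (complement_graph H) \<subseteq> pverts H \<times> pverts H"
    by (auto simp: complement_graph_def)
  then have "finite (parcs (complement_graph H))"
    by (rule finite_subset) (simp add: pair_finite_verts)
  then show ?thesis
    by unfold_locales
      (auto simp: complement_graph_def symmetric_def pair_finite_verts
        intro!: symI dest: arcs_symmetric)
qed

lemma pair_graph_lex_product: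
  assumes "pair_graph G" and "pair_graph H"
  shows "pair_graph (lex_product G H)"
proof -
  interpret G: pair_graph G by (rule assms)
  interpret H: pair_graph H by (rule assms)
  have "parcs (lex_product G H) \<subseteq> (pverts G \<times> pverts H) \<times> (pverts G \<times> pverts H)"
    by (auto simp: lex_product_def)
  then have "finite (parcs (lex_product G H))"
    by (rule finite_subset) (simp add: G.pair_finite_verts H.pair_finite_verts)
  then show ?thesis
    by unfold_locales
      (auto simp: lex_product_def symmetric_def G.pair_finite_verts H.pair_finite_verts
        intro!: symI dest: G.arcs_symmetric H.arcs_symmetric G.no_loops' H.no_loops')
qed

text \<open>
  The graph distance is the shortest-path cost with all arcs of weight \<open>1\<close>. It takes values in
  \<open>ereal\<close>, being \<open>\<infinity>\<close> between different components.
\<close>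
definition graph_dist :: "'a pair_pre_digraph \<Rightarrow> 'a \<Rightarrow> 'a \<Rightarrow> ereal" where
  "graph_dist X u v = wf_digraph.\<mu> (with_proj X) (\<lambda>_. 1) u v"

text \<open>An ordered set of vertices is a list without repetitions; its cardinality is the length.\<close>

definition ordered_vertex_set :: "'a pair_pre_digraph \<Rightarrow> 'a list \<Rightarrow> bool" where
  "ordered_vertex_set X W \<longleftrightarrow> distinct W \<and> set W \<subseteq> pverts X"

definition resolving_set :: "'a pair_pre_digraph \<Rightarrow> 'a list \<Rightarrow> bool" where
  "resolving_set X W \<longleftrightarrow>
    ordered_vertex_set X W \<and> inj_on (\<lambda>v. map (graph_dist X v) W) (pverts X)"

definition metric_dim :: "'a pair_pre_digraph \<Rightarrow> nat" where
  "metric_dim X = (LEAST k. \<exists>W. resolving_set X W \<and> length W = k)"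

definition adj_dist :: "'a pair_pre_digraph \<Rightarrow> 'a \<Rightarrow> 'a \<Rightarrow> nat" where
  "adj_dist H v w = (if v = w then 0 else if (v, w) \<in> parcs H then 1 else 2)"

definition adj_rep :: "'a pair_pre_digraph \<Rightarrow> 'a list \<Rightarrow> 'a \<Rightarrow> nat list" where
  "adj_rep H W v = map (adj_dist H v) W"

text \<open>
  For the empty list \<open>W\<close> every representation is entirely \<open>i\<close>, for every \<open>i\<close>.
\<close>
definition entirely :: "nat \<Rightarrow> nat list \<Rightarrow> bool" where
  "entirely i r \<longleftrightarrow> (\<forall>x \<in> set r. x = i)"

definition adj_resolving_set :: "'a pair_pre_digraph \<Rightarrow> 'a list \<Rightarrow> bool" where
  "adj_resolving_set H W \<longleftrightarrow> ordered_vertex_set H W \<and> inj_on (adj_rep H W) (pverts H)"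

definition adj_metric_dim :: "'a pair_pre_digraph \<Rightarrow> nat" where
  "adj_metric_dim H = (LEAST k. \<exists>W. adj_resolving_set H W \<and> length W = k)"

definition adj_basis :: "'a pair_pre_digraph \<Rightarrow> 'a list \<Rightarrow> bool" where
  "adj_basis H W \<longleftrightarrow> adj_resolving_set H W \<and> length W = adj_metric_dim H"

end

theory Submission
  imports Defs
begin

text \<open>
  In \<open>G[H]\<close> the distance between vertices in different fibres \<open>{v} \<times> H\<close> and \<open>{w} \<times> H\<close> is the
  distance of \<open>v\<close> and \<open>w\<close> in \<open>G\<close>, while inside one fibre two non-adjacent vertices are joined
  through any neighbouring fibre, so that distance there is the adjacency distance \<open>0, 1, 2\<close> of
  \<open>H\<close> (lemmas \<open>graph_dist_lex_across\<close> and \<open>graph_dist_lex_fibre\<close>).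

  Hence a vertex outside the fibre over \<open>v\<close> cannot separate two vertices of that fibre, so every
  resolving set must meet each fibre in an adjacency resolving set of \<open>H\<close>
  (\<open>adj_resolving_set_fibre\<close>). This gives the lower bound \<open>n \<beta>\<^sub>2(H)\<close>.

  For the upper bound, place an adjacency basis of \<open>H\<close> in each fibre. Vertices of one fibre are then
  separated. Two vertices \<open>(v, x)\<close>, \<open>(w, y)\<close> with \<open>v \<noteq> w\<close> can fail to be separated only if \<open>v\<close> and
  \<open>w\<close> have equal distances to every third vertex, that is, if they are twins in \<open>G\<close>. If they are
  adjacent twins, then failure forces \<open>x\<close> to have the representation entirely \<open>1\<close> with respect to
  the basis in the fibre over \<open>v\<close>, and if they are non-adjacent twins, it forces the representation
  entirely \<open>2\<close>. A vertex of \<open>G\<close> cannot have both an adjacent and a non-adjacent twin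
  (\<open>nonadjacent_twin_imp_no_adjacent_twin\<close>). Therefore \<open>W\<^sub>1\<close> can be put over the vertices with an
  adjacent twin and \<open>W\<^sub>2\<close> over all others, and nothing fails (\<open>ex_resolving_set_lex\<close>).

  Passing from \<open>H\<close> to its complement exchanges the values \<open>1\<close> and \<open>2\<close> of the adjacency distance. So
  adjacency bases are the same for both graphs, and the result for the complement follows from the
  one for \<open>H\<close> with \<open>W\<^sub>1\<close> and \<open>W\<^sub>2\<close> exchanged.
\<close>

section \<open>Graph distance\<close>

context pair_wf_digraph
begin

lemma graph_dist_eq_INF:
  "graph_dist G u v = (INF p\<in>{p. awalk u p v}. ereal (real (length p)))"
proof -
  have "awalk_cost (\<lambda>_. 1) p = real (length p)" for p
    by (induct p) auto
  then show ?thesis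
    by (simp add: graph_dist_def \<mu>_def)
qed

lemma graph_dist_le_length:
  assumes "awalk u p v"
  shows "graph_dist G u v \<le> ereal (real (length p))"
  unfolding graph_dist_eq_INF using assms by (auto intro: INF_lower)

lemma le_graph_distI:
  assumes "\<And>p. awalk u p v \<Longrightarrow> k \<le> length p"
  shows "ereal (real k) \<le> graph_dist G u v"
  unfolding graph_dist_eq_INF using assms by (auto intro!: INF_greatest)

lemma graph_dist_self:
  assumes "u \<in> pverts G"
  shows "graph_dist G u u = 0"
proof (rule antisym)
  show "graph_dist G u u \<le> 0"
    using graph_dist_le_length[of u "[]" u] assms by (simp add: awalk_Nil_iff zero_ereal_def)
  show "0 \<le> graph_dist G u u"
    using le_graph_distI[of u u 0] by (simp add: zero_ereal_def)
qed

lemma graph_dist_adjacent: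
  assumes "(u, v) \<in> parcs G" and "u \<noteq> v"
  shows "graph_dist G u v = 1"
proof (rule antisym)
  have "awalk u [(u, v)] v"
    using assms in_arcsD2 by (auto simp: awalk_Cons_iff awalk_Nil_iff)
  then show "graph_dist G u v \<le> 1"
    using graph_dist_le_length[of u "[(u, v)]" v] by (simp add: one_ereal_def)
  have "1 \<le> length p" if "awalk u p v" for p
    using that assms by (cases p) (auto simp: awalk_Nil_iff)
  then show "1 \<le> graph_dist G u v"
    using le_graph_distI[of u v 1] by (simp add: one_ereal_def)
qed

lemma two_le_graph_dist:
  assumes "(u, v) \<notin> parcs G" and "u \<noteq> v"
  shows "2 \<le> graph_dist G u v"
proof -
  have "2 \<le> length p" if "awalk u p v" for p
  proof (cases p)
    case Nil
    then show ?thesis using that assms by (simp add: awalk_Nil_iff)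
  next
    case (Cons e q)
    then show ?thesis using that assms
      by (cases q; cases e) (auto simp: awalk_Cons_iff awalk_Nil_iff)
  qed
  then show ?thesis
    using le_graph_distI[of u v 2] by simp
qed

lemma graph_dist_eq_1_iff:
  assumes "u \<noteq> v"
  shows "graph_dist G u v = 1 \<longleftrightarrow> (u, v) \<in> parcs G"
proof
  assume 1: "graph_dist G u v = 1"
  show "(u, v) \<in> parcs G"
  proof (rule ccontr)
    assume "(u, v) \<notin> parcs G"
    then have "(2 :: ereal) \<le> 1"
      using two_le_graph_dist assms 1 by metis
    then show False by simp
  qed
qed (use graph_dist_adjacent assms in auto)

text \<open>
  The adjacency distance is the graph distance truncated at \<open>2\<close>, so a common neighbour is all that
  is needed for the two to agree.
\<close>
lemma graph_dist_eq_adj_dist: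
  assumes "u \<in> pverts G"
    and "u \<noteq> v \<Longrightarrow> (u, v) \<notin> parcs G \<Longrightarrow> \<exists>z. (u, z) \<in> parcs G \<and> (z, v) \<in> parcs G"
  shows "graph_dist G u v = ereal (real (adj_dist G u v))"
proof -
  consider "u = v" | "u \<noteq> v" "(u, v) \<in> parcs G" | "u \<noteq> v" "(u, v) \<notin> parcs G"
    by blast
  then show ?thesis
  proof cases
    case 1
    then show ?thesis using assms(1)
      by (simp add: graph_dist_self adj_dist_def zero_ereal_def)
  next
    case 2
    then show ?thesis by (simp add: graph_dist_adjacent adj_dist_def one_ereal_def)
  next
    case 3
    then obtain z where z: "(u, z) \<in> parcs G" "(z, v) \<in> parcs G"
      using assms(2) by blast
    then have "awalk u [(u, z), (z, v)] v"
      using in_arcsD2 by (auto simp: awalk_Cons_iff awalk_Nil_iff)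
    then have "graph_dist G u v \<le> 2"
      using graph_dist_le_length[of u "[(u, z), (z, v)]" v] by simp
    then have "graph_dist G u v = 2"
      using two_le_graph_dist[of u v] 3 by (intro antisym)
    with 3 show ?thesis by (simp add: adj_dist_def)
  qed
qed

end

lemma connected_obtain_neighbour:
  assumes "pair_graph G" and "Digraph_Component.connected (with_proj G)"
    and "card (pverts G) \<ge> 2" and "v \<in> pverts G"
  obtains u where "(v, u) \<in> parcs G"
proof -
  interpret pair_graph G by (rule assms(1))
  have "strongly_connected (with_proj G)"
    using symmetric_connected_imp_strongly_connected assms(2) sym_arcs by blast
  moreover obtain w where w: "w \<in> pverts G" "w \<noteq> v"
  proof -
    have "\<not> pverts G \<subseteq> {v}"
      using assms(3) card_mono[of "{v}" "pverts G"] by auto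
    then show ?thesis using that by blast
  qed
  ultimately obtain p where p: "awalk v p w"
    using assms(4) reachable_awalk strongly_connectedE by (metis with_proj_simps(1))
  with w obtain e q where "p = e # q"
    by (cases p) (auto simp: awalk_Nil_iff)
  with p have "(v, snd e) \<in> parcs G"
    by (cases e) (auto simp: awalk_Cons_iff)
  then show ?thesis by (rule that)
qed

section \<open>Distance in the lexicographic product\<close>

lemma pverts_lex_product [simp]: "pverts (lex_product G H) = pverts G \<times> pverts H"
  by (simp add: lex_product_def)

lemma parcs_lex_product_iff:
  "((v, x), (w, y)) \<in> parcs (lex_product G H) \<longleftrightarrow>
    v \<in> pverts G \<and> x \<in> pverts H \<and> w \<in> pverts G \<and> y \<in> pverts H \<and>
    ((v, w) \<in> parcs G \<or> v = w \<and> (x, y) \<in> parcs H)"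
  by (auto simp: lex_product_def)

lemma graph_dist_lex_fibre:
  assumes "pair_graph G" and "pair_graph H"
    and "(v, u) \<in> parcs G" and "x \<in> pverts H" and "y \<in> pverts H"
  shows "graph_dist (lex_product G H) (v, x) (v, y) = ereal (real (adj_dist H x y))"
proof -
  interpret G: pair_graph G by (rule assms(1))
  interpret P: pair_graph "lex_product G H"
    using assms(1,2) by (rule pair_graph_lex_product)
  have vu: "v \<in> pverts G" "u \<in> pverts G" "(u, v) \<in> parcs G"
    using assms(3) G.in_arcsD1 G.in_arcsD2 G.arcs_symmetric by blast+
  have "((v, x), (u, x)) \<in> parcs (lex_product G H)"
      "((u, x), (v, y)) \<in> parcs (lex_product G H)"
    using assms(3-5) vu by (auto simp: parcs_lex_product_iff)
  then have "graph_dist (lex_product G H) (v, x) (v, y)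
      = ereal (real (adj_dist (lex_product G H) (v, x) (v, y)))"
    using assms(4) vu by (intro P.graph_dist_eq_adj_dist) auto
  also have "adj_dist (lex_product G H) (v, x) (v, y) = adj_dist H x y"
    using assms(4,5) vu G.no_loops' by (auto simp: adj_dist_def parcs_lex_product_iff)
  finally show ?thesis .
qed

text \<open>
  A walk of \<open>G\<close> lifts to the product by moving to the target's second coordinate with its first
  step; a walk of length \<open>0\<close> has no such step, hence the condition \<open>v = w \<Longrightarrow> x = y\<close>.
\<close>
lemma awalk_lift_lex:
  assumes "pair_wf_digraph G" and "pair_wf_digraph (lex_product G H)"
    and "pre_digraph.awalk (with_proj G) v p w"
    and "x \<in> pverts H" and "y \<in> pverts H" and "v = w \<Longrightarrow> x = y"
  shows "\<exists>q. pre_digraph.awalk (with_proj (lex_product G H)) (v, x) q (w, y)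
    \<and> length q \<le> length p"
proof -
  interpret G: pair_wf_digraph G by (rule assms(1))
  interpret P: pair_wf_digraph "lex_product G H" by (rule assms(2))
  show ?thesis using assms(3,4,6)
  proof (induct p arbitrary: v x)
    case Nil
    then have "P.awalk (v, x) [] (w, y)"
      using assms(5) by (auto simp: G.awalk_Nil_iff P.awalk_Nil_iff)
    then show ?case by (intro exI[of _ "[]"] conjI) simp_all
  next
    case (Cons e p)
    obtain z where e: "e = (v, z)" and arc: "(v, z) \<in> parcs G" and p: "G.awalk z p w"
      using Cons.prems(1) by (cases e) (auto simp: G.awalk_Cons_iff)
    obtain q where q: "P.awalk (z, y) q (w, y)" "length q \<le> length p"
      using Cons.hyps[OF p assms(5)] by blast
    have "((v, x), (z, y)) \<in> parcs (lex_product G H)"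
      using arc Cons.prems(2) assms(5) G.in_arcsD1 G.in_arcsD2
      by (auto simp: parcs_lex_product_iff)
    then have "P.awalk (v, x) (((v, x), (z, y)) # q) (w, y)"
      using q(1) by (simp add: P.awalk_Cons_iff)
    then show ?case
      using q(2) by (intro exI[of _ "((v, x), (z, y)) # q"] conjI) simp_all
  qed
qed

text \<open>Steps inside a fibre disappear under the projection, so walks can only become shorter.\<close>
lemma awalk_project_lex:
  assumes "pair_wf_digraph G" and "pair_wf_digraph (lex_product G H)"
    and "pre_digraph.awalk (with_proj (lex_product G H)) a q b"
  shows "\<exists>p. pre_digraph.awalk (with_proj G) (fst a) p (fst b) \<and> length p \<le> length q"
proof -
  interpret G: pair_wf_digraph G by (rule assms(1))
  interpret P: pair_wf_digraph "lex_product G H" by (rule assms(2))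
  show ?thesis using assms(3)
  proof (induct q arbitrary: a)
    case Nil
    then have "G.awalk (fst a) [] (fst b)"
      by (auto simp: G.awalk_Nil_iff P.awalk_Nil_iff)
    then show ?case by (intro exI[of _ "[]"] conjI) simp_all
  next
    case (Cons e q)
    obtain v x w y where e: "e = ((v, x), (w, y))" by (metis surj_pair)
    have arc: "((v, x), (w, y)) \<in> parcs (lex_product G H)" and a: "a = (v, x)"
      and q: "P.awalk (w, y) q b"
      using Cons.prems e by (auto simp: P.awalk_Cons_iff)
    obtain p where p: "G.awalk w p (fst b)" "length p \<le> length q"
      using Cons.hyps[OF q] by auto
    from arc consider "(v, w) \<in> parcs G" | "v = w"
      by (auto simp: parcs_lex_product_iff)
    then show ?case
    proof cases
      case 1
      then have "G.awalk v ((v, w) # p) (fst b)"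
        using p(1) by (simp add: G.awalk_Cons_iff)
      then show ?thesis
        using p(2) a by (intro exI[of _ "(v, w) # p"] conjI) simp_all
    next
      case 2
      then have "G.awalk (fst a) p (fst b)" using p(1) a by simp
      then show ?thesis
        using p(2) by (intro exI[of _ p] conjI) simp_all
    qed
  qed
qed

lemma graph_dist_lex_across:
  assumes "pair_graph G" and "pair_graph H"
    and "v \<noteq> w" and "x \<in> pverts H" and "y \<in> pverts H"
  shows "graph_dist (lex_product G H) (v, x) (w, y) = graph_dist G v w"
proof (rule antisym)
  interpret G: pair_graph G by (rule assms(1))
  interpret P: pair_graph "lex_product G H"
    using assms(1,2) by (rule pair_graph_lex_product)
  have wf: "pair_wf_digraph G" "pair_wf_digraph (lex_product G H)"
    by unfold_locales
  have "graph_dist (lex_product G H) (v, x) (w, y) \<le> ereal (real (length p))"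
    if "G.awalk v p w" for p
    using awalk_lift_lex[OF wf that assms(4,5)] assms(3) P.graph_dist_le_length
    by (meson ereal_less_eq(3) of_nat_le_iff order_trans)
  then show "graph_dist (lex_product G H) (v, x) (w, y) \<le> graph_dist G v w"
    unfolding G.graph_dist_eq_INF by (auto intro!: INF_greatest)
  have "graph_dist G v w \<le> ereal (real (length q))" if "P.awalk (v, x) q (w, y)" for q
    using awalk_project_lex[OF wf that] G.graph_dist_le_length
    by (metis ereal_less_eq(3) fst_conv of_nat_le_iff order_trans)
  then show "graph_dist G v w \<le> graph_dist (lex_product G H) (v, x) (w, y)"
    unfolding P.graph_dist_eq_INF by (auto intro!: INF_greatest)
qed

section \<open>Resolving sets of the product\<close>

lemma resolving_set_iff:
  "resolving_set X W \<longleftrightarrow> ordered_vertex_set X W \<and>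
    (\<forall>a \<in> pverts X. \<forall>b \<in> pverts X.
      (\<forall>w \<in> set W. graph_dist X a w = graph_dist X b w) \<longrightarrow> a = b)"
  by (auto simp: resolving_set_def inj_on_def)

lemma adj_resolving_set_iff:
  "adj_resolving_set X W \<longleftrightarrow> ordered_vertex_set X W \<and>
    (\<forall>a \<in> pverts X. \<forall>b \<in> pverts X.
      (\<forall>w \<in> set W. adj_dist X a w = adj_dist X b w) \<longrightarrow> a = b)"
  by (auto simp: adj_resolving_set_def adj_rep_def inj_on_def)

lemma entirely_adj_rep_iff:
  "entirely i (adj_rep X W v) \<longleftrightarrow> (\<forall>w \<in> set W. adj_dist X v w = i)"
  by (auto simp: entirely_def adj_rep_def)

lemma adj_metric_dim_le:
  assumes "adj_resolving_set H W"
  shows "adj_metric_dim H \<le> length W"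
  unfolding adj_metric_dim_def using assms by (auto intro: Least_le)

text \<open>
  The members of a resolving set outside a fibre see all of its vertices at the same distance, so
  those inside must separate them, and inside the fibre only the adjacency distance of \<open>H\<close> counts.
\<close>
lemma adj_resolving_set_fibre:
  assumes "pair_graph G" and "pair_graph H"
    and "resolving_set (lex_product G H) S" and "(v, u) \<in> parcs G"
  shows "adj_resolving_set H (map snd (filter (\<lambda>a. fst a = v) S))"
proof -
  interpret G: pair_graph G by (rule assms(1))
  let ?F = "map snd (filter (\<lambda>a. fst a = v) S)"
  have S: "distinct S" "set S \<subseteq> pverts G \<times> pverts H"
    using assms(3) by (auto simp: resolving_set_def ordered_vertex_set_def)
  have "ordered_vertex_set H ?F"
    using S by (auto simp: ordered_vertex_set_def distinct_map inj_on_def)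
  moreover have "x = y"
    if xy: "x \<in> pverts H" "y \<in> pverts H"
      and eq: "\<forall>w \<in> set ?F. adj_dist H x w = adj_dist H y w" for x y
  proof -
    have "graph_dist (lex_product G H) (v, x) a = graph_dist (lex_product G H) (v, y) a"
      if "a \<in> set S" for a
    proof -
      obtain w s where a: "a = (w, s)" by (cases a)
      then have s: "s \<in> pverts H" using that S by auto
      show ?thesis
      proof (cases "w = v")
        case True
        then have "s \<in> set ?F" using that a by force
        then show ?thesis
          using graph_dist_lex_fibre[OF assms(1,2,4)] xy s bspec[OF eq] a True by presburger
      next
        case False
        then show ?thesis
          using graph_dist_lex_across[OF assms(1,2)] xy s a by metis
      qed
    qed
    moreover have "(v, x) \<in> pverts (lex_product G H)" "(v, y) \<in> pverts (lex_product G H)"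
      using xy G.in_arcsD1[OF assms(4)] by simp_all
    ultimately have "(v, x) = (v, y)"
      using assms(3) unfolding resolving_set_iff by blast
    then show ?thesis by simp
  qed
  ultimately show ?thesis unfolding adj_resolving_set_iff by blast
qed

lemma length_eq_sum_fibres:
  assumes "finite V" and "fst ` set S \<subseteq> V"
  shows "length S = (\<Sum>v\<in>V. length (filter (\<lambda>a. fst a = v) S))"
  using assms(2)
proof (induct S)
  case (Cons a S)
  have "(\<Sum>v\<in>V. length (filter (\<lambda>a. fst a = v) (a # S)))
      = (\<Sum>v\<in>V. (if fst a = v then 1 else 0) + length (filter (\<lambda>a. fst a = v) S))"
    by (rule sum.cong) auto
  with Cons assms(1) show ?case by (simp add: sum.distrib)
qed simp

lemma length_resolving_set_ge:
  assumes "pair_graph G" and "Digraph_Component.connected (with_proj G)"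
    and "card (pverts G) \<ge> 2" and "pair_graph H"
    and "resolving_set (lex_product G H) S"
  shows "card (pverts G) * adj_metric_dim H \<le> length S"
proof -
  interpret G: pair_graph G by (rule assms(1))
  have "adj_metric_dim H \<le> length (filter (\<lambda>a. fst a = v) S)" if "v \<in> pverts G" for v
    using connected_obtain_neighbour[OF assms(1-3) that]
      adj_metric_dim_le adj_resolving_set_fibre[OF assms(1,4,5)] by (metis length_map)
  then have "(\<Sum>v\<in>pverts G. adj_metric_dim H)
      \<le> (\<Sum>v\<in>pverts G. length (filter (\<lambda>a. fst a = v) S))"
    by (rule sum_mono)
  also have "\<dots> = length S"
    using assms(5) G.pair_finite_verts
    by (intro length_eq_sum_fibres[symmetric])
      (auto simp: resolving_set_def ordered_vertex_set_def)
  finally show ?thesis by simp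
qed

definition adjacent_twins :: "'a pair_pre_digraph \<Rightarrow> 'a \<Rightarrow> 'a \<Rightarrow> bool" where
  "adjacent_twins G v w \<longleftrightarrow> (v, w) \<in> parcs G \<and>
    (\<forall>z \<in> pverts G - {v, w}. (v, z) \<in> parcs G \<longleftrightarrow> (w, z) \<in> parcs G)"

text \<open>
  For non-adjacent twins \<open>v\<close>, \<open>w\<close>, an adjacent twin of \<open>v\<close> would be a neighbour of \<open>v\<close>, hence of
  \<open>w\<close>, and would pass its neighbour \<open>w\<close> on to \<open>v\<close>.
\<close>
lemma nonadjacent_twin_imp_no_adjacent_twin:
  assumes "pair_graph G" and "v \<noteq> w" and "w \<in> pverts G" and "(v, w) \<notin> parcs G"
    and "\<forall>z \<in> pverts G - {v, w}. (v, z) \<in> parcs G \<longleftrightarrow> (w, z) \<in> parcs G"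
  shows "\<not> adjacent_twins G v u"
proof
  interpret pair_graph G by (rule assms(1))
  assume tw: "adjacent_twins G v u"
  then have vu: "(v, u) \<in> parcs G" by (simp add: adjacent_twins_def)
  then have "u \<in> pverts G - {v, w}"
    using assms(4) no_loops' in_arcsD2 by blast
  with vu assms(5) have "(u, w) \<in> parcs G"
    using arcs_symmetric by blast
  moreover have "w \<in> pverts G - {v, u}"
    using assms vu by auto
  ultimately show False
    using tw assms(4) by (auto simp: adjacent_twins_def)
qed

text \<open>
  The resolving set of the upper bound. The two hypotheses on \<open>W1\<close> and \<open>W2\<close> also make these lists
  non-empty as soon as \<open>H\<close> has a vertex, so that every fibre contains a member that compares the
  distances in \<open>G\<close>.
\<close>
lemma ex_resolving_set_lex:
  assumes "pair_graph G" and "Digraph_Component.connected (with_proj G)"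
    and "card (pverts G) \<ge> 2" and "pair_graph H"
    and "adj_resolving_set H W1" and "adj_resolving_set H W2"
    and "length W1 = k" and "length W2 = k"
    and no1: "\<And>x. x \<in> pverts H \<Longrightarrow> \<not> entirely 1 (adj_rep H W1 x)"
    and no2: "\<And>x. x \<in> pverts H \<Longrightarrow> \<not> entirely 2 (adj_rep H W2 x)"
  shows "\<exists>S. resolving_set (lex_product G H) S \<and> length S = card (pverts G) * k"
proof -
  interpret G: pair_graph G by (rule assms(1))
  let ?d = "graph_dist (lex_product G H)"
  obtain vs where vs: "distinct vs" "set vs = pverts G"
    using finite_distinct_list[OF G.pair_finite_verts] by blast
  define f where "f v = (if \<exists>u. adjacent_twins G v u then W1 else W2)" for v
  define S where "S = concat (map (\<lambda>v. map (Pair v) (f v)) vs)"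
  have f: "adj_resolving_set H (f v)" "length (f v) = k" for v
    using assms(5-8) by (auto simp: f_def)
  then have f_ord: "distinct (f v)" "set (f v) \<subseteq> pverts H" for v
    by (auto simp: adj_resolving_set_def ordered_vertex_set_def)
  have set_S: "(v, s) \<in> set S \<longleftrightarrow> v \<in> pverts G \<and> s \<in> set (f v)" for v s
    by (auto simp: S_def vs(2))
  have f_nonempty: "set (f v) \<noteq> {}" if "x \<in> pverts H" for v x
    using no1[OF that] no2[OF that] by (auto simp: f_def entirely_adj_rep_iff)

  have "length S = length vs * k"
    unfolding S_def by (induct vs) (auto simp: f(2))
  then have length_S: "length S = card (pverts G) * k"
    using vs distinct_card by metis
  have "distinct S"
    unfolding S_def using vs(1)
    by (induct vs) (auto simp: distinct_map f_ord(1) inj_on_def)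
  then have ord_S: "ordered_vertex_set (lex_product G H) S"
    using set_S f_ord(2) by (fastforce simp: ordered_vertex_set_def)

  have "a = b"
    if ab: "a \<in> pverts G \<times> pverts H" "b \<in> pverts G \<times> pverts H"
      and eq: "\<forall>c \<in> set S. ?d a c = ?d b c" for a b
  proof -
    obtain v x w y where a: "a = (v, x)" and b: "b = (w, y)"
      by (cases a, cases b)
    have v: "v \<in> pverts G" and w: "w \<in> pverts G" and x: "x \<in> pverts H" and y: "y \<in> pverts H"
      using ab a b by auto
    have eq_at: "?d (v, x) (z, s) = ?d (w, y) (z, s)" if "z \<in> pverts G" "s \<in> set (f z)" for z s
      using eq set_S that a b by blast
    obtain u where u: "(v, u) \<in> parcs G"
      using connected_obtain_neighbour[OF assms(1-3) v] .
    have fibre: "?d (v, x') (v, s) = ereal (real (adj_dist H x' s))"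
      if "x' \<in> pverts H" "s \<in> set (f v)" for x' s
      using graph_dist_lex_fibre[OF assms(1,4) u] that f_ord(2) by blast
    show ?thesis
    proof (cases "v = w")
      case True
      have "adj_dist H x s = adj_dist H y s" if "s \<in> set (f v)" for s
        using eq_at[OF v that] fibre[OF x that] fibre[OF y that] True by simp
      then have "x = y"
        using f(1)[of v] x y by (auto simp: adj_resolving_set_iff)
      then show ?thesis using True a b by simp
    next
      case vw: False
      have twins: "(v, z) \<in> parcs G \<longleftrightarrow> (w, z) \<in> parcs G" if z: "z \<in> pverts G - {v, w}" for z
      proof -
        obtain s where s: "s \<in> set (f z)" using f_nonempty[OF x, of z] by (metis ex_in_conv)
        then have "s \<in> pverts H" using f_ord(2) by blast
        then have "?d (v, x) (z, s) = graph_dist G v z" "?d (w, y) (z, s) = graph_dist G w z"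
          using graph_dist_lex_across[OF assms(1,4)] z x y by auto
        then have "graph_dist G v z = graph_dist G w z"
          using eq_at s z by auto
        then show ?thesis
          using G.graph_dist_eq_1_iff[of v z] G.graph_dist_eq_1_iff[of w z] z by auto
      qed
      \<comment> \<open>Non-adjacent twins share all neighbours, and \<open>v\<close> has one, so they are at distance \<open>2\<close>.\<close>
      have common: "\<exists>z. (w, z) \<in> parcs G \<and> (z, v) \<in> parcs G" if nadj: "(w, v) \<notin> parcs G"
      proof -
        have "u \<in> pverts G - {v, w}"
          using u nadj G.no_loops' G.in_arcsD2 G.arcs_symmetric by blast
        then show ?thesis using twins u G.arcs_symmetric by blast
      qed
      have rep: "adj_dist H x s = adj_dist G w v" if s: "s \<in> set (f v)" for s
      proof -
        have "ereal (real (adj_dist H x s)) = ?d (w, y) (v, s)"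
          using fibre[OF x s] eq_at[OF v s] by simp
        also have "\<dots> = graph_dist G w v"
          using graph_dist_lex_across[OF assms(1,4), of w v y s] vw y s f_ord(2) by auto
        also have "\<dots> = ereal (real (adj_dist G w v))"
          using common by (intro G.graph_dist_eq_adj_dist[OF w])
        finally show ?thesis by simp
      qed
      show ?thesis
      proof (cases "(v, w) \<in> parcs G")
        case True
        then have "f v = W1"
          using twins by (auto simp: f_def adjacent_twins_def)
        moreover have "adj_dist G w v = 1"
          using True vw G.arcs_symmetric by (auto simp: adj_dist_def)
        ultimately show ?thesis
          using no1[OF x] rep by (simp add: entirely_adj_rep_iff)
      next
        case False
        then have "f v = W2"
          using nonadjacent_twin_imp_no_adjacent_twin[OF assms(1) vw w] twins
          by (auto simp: f_def)
        moreover have "adj_dist G w v = 2"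
          using False vw G.arcs_symmetric by (auto simp: adj_dist_def)
        ultimately show ?thesis
          using no2[OF x] rep by (simp add: entirely_adj_rep_iff)
      qed
    qed
  qed
  then have "resolving_set (lex_product G H) S"
    using ord_S unfolding resolving_set_iff by simp
  with length_S show ?thesis by blast
qed

lemma metric_dim_lex_product:
  assumes "pair_graph G" and "Digraph_Component.connected (with_proj G)"
    and "card (pverts G) \<ge> 2" and "pair_graph H"
    and "adj_basis H W1" and "adj_basis H W2"
    and "\<And>x. x \<in> pverts H \<Longrightarrow> \<not> entirely 1 (adj_rep H W1 x)"
    and "\<And>x. x \<in> pverts H \<Longrightarrow> \<not> entirely 2 (adj_rep H W2 x)"
  shows "metric_dim (lex_product G H) = card (pverts G) * adj_metric_dim H"
  unfolding metric_dim_def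
proof (rule Least_equality)
  show "\<exists>S. resolving_set (lex_product G H) S
      \<and> length S = card (pverts G) * adj_metric_dim H"
    using assms by (intro ex_resolving_set_lex[of G H W1 W2]) (auto simp: adj_basis_def)
next
  fix k
  assume "\<exists>S. resolving_set (lex_product G H) S \<and> length S = k"
  then show "card (pverts G) * adj_metric_dim H \<le> k"
    using length_resolving_set_ge[OF assms(1-4)] by blast
qed

section \<open>Complements\<close>

lemma pverts_complement_graph [simp]: "pverts (complement_graph H) = pverts H"
  by (simp add: complement_graph_def)

text \<open>
  \<open>(3 - k) mod 3\<close> is the exchange of \<open>1\<close> and \<open>2\<close> that fixes \<open>0\<close>.
\<close>
lemma adj_dist_complement_graph:
  assumes "v \<in> pverts H" and "w \<in> pverts H"
  shows "adj_dist (complement_graph H) v w = (3 - adj_dist H v w) mod 3"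
  using assms by (simp add: adj_dist_def complement_graph_def)

lemma adj_dist_complement_graph_eq_iff:
  assumes "v \<in> pverts H" and "v' \<in> pverts H" and "w \<in> pverts H"
  shows "adj_dist (complement_graph H) v w = adj_dist (complement_graph H) v' w \<longleftrightarrow>
    adj_dist H v w = adj_dist H v' w"
  unfolding adj_dist_complement_graph[OF assms(1,3)] adj_dist_complement_graph[OF assms(2,3)]
  by (simp add: adj_dist_def)

lemma adj_resolving_set_complement_graph:
  "adj_resolving_set (complement_graph H) = adj_resolving_set H"
proof (rule ext)
  fix W
  show "adj_resolving_set (complement_graph H) W = adj_resolving_set H W"
  proof (cases "ordered_vertex_set H W")
    case True
    then have "set W \<subseteq> pverts H" by (simp add: ordered_vertex_set_def)
    then have "(\<forall>w\<in>set W. adj_dist (complement_graph H) a w = adj_dist (complement_graph H) b w)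
        \<longleftrightarrow> (\<forall>w\<in>set W. adj_dist H a w = adj_dist H b w)"
      if "a \<in> pverts H" "b \<in> pverts H" for a b
      using adj_dist_complement_graph_eq_iff[OF that] by (meson subsetD)
    then show ?thesis
      by (simp add: adj_resolving_set_iff ordered_vertex_set_def)
  next
    case False
    then show ?thesis by (auto simp: adj_resolving_set_def ordered_vertex_set_def)
  qed
qed

lemma adj_metric_dim_complement_graph:
  "adj_metric_dim (complement_graph H) = adj_metric_dim H"
  by (simp add: adj_metric_dim_def adj_resolving_set_complement_graph)

lemma entirely_complement_graph:
  assumes "set W \<subseteq> pverts H" and "v \<in> pverts H"
  shows "entirely 1 (adj_rep (complement_graph H) W v) \<longleftrightarrow> entirely 2 (adj_rep H W v)"
    and "entirely 2 (adj_rep (complement_graph H) W v) \<longleftrightarrow> entirely 1 (adj_rep H W v)"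
proof -
  have "adj_dist (complement_graph H) v w = 1 \<longleftrightarrow> adj_dist H v w = 2"
    "adj_dist (complement_graph H) v w = 2 \<longleftrightarrow> adj_dist H v w = 1" if "w \<in> set W" for w
    using adj_dist_complement_graph[OF assms(2), of w] assms(1) that
    by (auto simp: adj_dist_def[of H])
  then show "entirely 1 (adj_rep (complement_graph H) W v) \<longleftrightarrow> entirely 2 (adj_rep H W v)"
    and "entirely 2 (adj_rep (complement_graph H) W v) \<longleftrightarrow> entirely 1 (adj_rep H W v)"
    by (simp_all add: entirely_adj_rep_iff)
qed

theorem theorem1:
  fixes G :: "'a pair_pre_digraph" and H :: "'b pair_pre_digraph"
    and n :: nat and W1 W2 :: "'b list"
  assumes "pair_graph G" and "Digraph_Component.connected (with_proj G)"
    and "card (pverts G) = n" and "n \<ge> 2"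
    and "pair_graph H"
    and "adj_basis H W1" and "adj_basis H W2"
    and "\<not> (\<exists>v \<in> pverts H. entirely 1 (adj_rep H W1 v))"
    and "\<not> (\<exists>v \<in> pverts H. entirely 2 (adj_rep H W2 v))"
  shows "metric_dim (lex_product G H) = n * adj_metric_dim H
    \<and> metric_dim (lex_product G (complement_graph H)) = n * adj_metric_dim H"
proof
  have n: "card (pverts G) \<ge> 2" using assms(3,4) by simp
  show "metric_dim (lex_product G H) = n * adj_metric_dim H"
    using metric_dim_lex_product[OF assms(1,2) n assms(5-7)] assms(3,8,9) by blast
  have W: "set W1 \<subseteq> pverts H" "set W2 \<subseteq> pverts H"
    using assms(6,7) by (auto simp: adj_basis_def adj_resolving_set_def ordered_vertex_set_def)
  have bases: "adj_basis (complement_graph H) W2" "adj_basis (complement_graph H) W1"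
    using assms(6,7)
    by (simp_all add: adj_basis_def adj_resolving_set_complement_graph
        adj_metric_dim_complement_graph)
  have "metric_dim (lex_product G (complement_graph H))
      = card (pverts G) * adj_metric_dim (complement_graph H)"
    using assms(8,9) entirely_complement_graph(1)[OF W(2)] entirely_complement_graph(2)[OF W(1)]
    by (intro metric_dim_lex_product[OF assms(1,2) n
          pair_graph_complement_graph[OF assms(5)] bases]) auto
  then show "metric_dim (lex_product G (complement_graph H)) = n * adj_metric_dim H"
    by (simp add: assms(3) adj_metric_dim_complement_graph)
qed

end
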